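(* Let $p_1(t),\ldots,p_n(t)\in \mathbb{K}[t]$ be linearly independent over $\mathbb{K}$. Then the Wronskian $W(p_1,\ldots,p_n)$ is a nonzero constant if and only if there exists a nonsingular $n\times n$ matrix $A$ with entries in $\mathbb{K}$ such that $$\begin{bmatrix} p_1(t)\\ p_2(t)\\ \vdots\\ p_n(t)\end{bmatrix}=A\cdot\begin{bmatrix}1\\ t\\ \vdots\\ t^{n-1}\end{bmatrix}.$$
   Context: $\mathbb{K}$ is a field of characteristic zero, $n$ is a positive integer. The Wronskian $W(p_1,\ldots,p_n)$ is the determinant of the $n\times n$ matrix whose entry in row $k$ and column $j$ is the $(k-1)$-th derivative $p_j^{(k-1)}(t)$, $1\le k,j\le n$; it is an element of $\mathbb{K}[t]$. "Nonzero constant" means a nonzero element of $\mathbb{K}$. *)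

theory Defs
  imports "Jordan_Normal_Form.Determinant"
begin

(* Families p_1, ..., p_n of polynomials are vectors of dimension n over the polynomial
   ring; all indices are shifted to 0, ..., n - 1. *)

definition wronskian_mat :: "'a :: field_char_0 poly vec \<Rightarrow> 'a poly mat" where
  "wronskian_mat p = mat (dim_vec p) (dim_vec p) (\<lambda>(k, j). (pderiv ^^ k) (p $ j))"

definition wronskian :: "'a :: field_char_0 poly vec \<Rightarrow> 'a poly" where
  "wronskian p = det (wronskian_mat p)"

(* Independence of the indexed family, not of its set of values: a family with a
   repeated entry is dependent. *)
definition lin_indep_family :: "'a :: field poly vec \<Rightarrow> bool" where
  "lin_indep_family p \<longleftrightarrow>
     (\<forall>c :: nat \<Rightarrow> 'a. (\<Sum>i<dim_vec p. smult (c i) (p $ i)) = 0 \<longrightarrow> (\<forall>i<dim_vec p. c i = 0))"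

definition monomial_vec :: "nat \<Rightarrow> 'a :: comm_semiring_1 poly vec" where
  "monomial_vec n = vec n (\<lambda>i. monom 1 i)"

(* A scalar matrix, read as a matrix of constant polynomials. *)
definition const_poly_mat :: "'a :: comm_semiring_1 mat \<Rightarrow> 'a poly mat" where
  "const_poly_mat A = map_mat (\<lambda>c. [:c:]) A"

end

theory Submission
  imports Defs
begin

text \<open>
  Two facts about the Wronskian drive the proof. It is natural under scalar matrices,
  \<open>W(A q) = W(q) \<cdot> det A\<close>, because differentiation is linear over constants
  (\<open>wronskian_const_mult\<close>). And when the \<open>q\<^sub>j\<close> are nonzero of pairwise distinct degrees \<open>d\<^sub>j\<close>, then
  \<open>W(q)\<close> has degree exactly \<open>\<Sum>d\<^sub>j - (0 + \<dots> + (n - 1))\<close>: the coefficient in question is, up to the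
  leading coefficients, the determinant of the falling factorials
  \<open>d\<^sub>j (d\<^sub>j - 1) \<dots> (d\<^sub>j - k + 1)\<close>, a Vandermonde determinant in disguise, which does not vanish in
  characteristic zero (\<open>coeff_wronskian_distinct_degrees\<close>).

  The monomials have Wronskian \<open>0! 1! \<dots> (n - 1)!\<close>, so the first fact gives the direction from the
  matrix to the constant Wronskian. Conversely, let \<open>W(p)\<close> be a nonzero constant. If the degrees are
  distinct, they add up to \<open>0 + \<dots> + (n - 1)\<close>, and the only set of \<open>n\<close> naturals with that sum is
  \<open>{0, \<dots>, n - 1}\<close>; hence all \<open>p\<^sub>j\<close> have degree less than \<open>n\<close>. If two degrees agree, cancelling a leading
  term is a column operation that keeps the Wronskian and lowers the total degree, so the bound
  follows by induction (\<open>degree_less_if_wronskian_const\<close>). Having degree less than \<open>n\<close> means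
  \<open>p = A (1, t, \<dots>, t\<^sup>n\<^sup>-\<^sup>1)\<close> for the matrix \<open>A\<close> of coefficients, and the first fact shows
  \<open>det A \<noteq> 0\<close>, because \<open>W(p) \<noteq> 0\<close>.
\<close>

section \<open>Wronskians under scalar matrices\<close>

lemma wronskian_mat_carrier [simp]:
  "q \<in> carrier_vec n \<Longrightarrow> wronskian_mat q \<in> carrier_mat n n"
  by (simp add: wronskian_mat_def)

lemma wronskian_mat_index:
  "q \<in> carrier_vec n \<Longrightarrow> k < n \<Longrightarrow> j < n \<Longrightarrow> wronskian_mat q $$ (k, j) = (pderiv ^^ k) (q $ j)"
  by (simp add: wronskian_mat_def)

lemma const_poly_mat_carrier [simp]:
  "A \<in> carrier_mat m n \<Longrightarrow> const_poly_mat A \<in> carrier_mat m n"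
  by (simp add: const_poly_mat_def)

lemma monomial_vec_carrier [simp]: "monomial_vec n \<in> carrier_vec n"
  by (simp add: monomial_vec_def)

lemma const_poly_mat_mult_index:
  assumes "A \<in> carrier_mat m n" "q \<in> carrier_vec n" "j < m"
  shows "(const_poly_mat A *\<^sub>v q) $ j = (\<Sum>i<n. smult (A $$ (j, i)) (q $ i))"
  using assms
  by (auto simp: const_poly_mat_def scalar_prod_def atLeast0LessThan intro!: sum.cong)

lemma det_const_poly_mat: "det (const_poly_mat (A :: 'a :: comm_ring_1 mat)) = [:det A:]"
proof -
  interpret comm_ring_hom "\<lambda>c :: 'a. [:c:]"
    by unfold_locales auto
  show ?thesis by (simp add: const_poly_mat_def)
qed

lemma wronskian_const_mult:
  fixes A :: "'a :: field_char_0 mat"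
  assumes A: "A \<in> carrier_mat n n" and q: "q \<in> carrier_vec n"
  shows "wronskian (const_poly_mat A *\<^sub>v q) = wronskian q * [:det A:]"
proof -
  have v: "const_poly_mat A *\<^sub>v q \<in> carrier_vec n"
    using A q by (intro mult_mat_vec_carrier[of _ n n]) auto
  have "wronskian_mat (const_poly_mat A *\<^sub>v q) = wronskian_mat q * transpose_mat (const_poly_mat A)"
  proof (rule eq_matI, goal_cases)
    case (1 k j)
    then have k: "k < n" and j: "j < n"
      using A q by (auto simp: wronskian_mat_def const_poly_mat_def)
    have "wronskian_mat (const_poly_mat A *\<^sub>v q) $$ (k, j)
        = (\<Sum>i<n. smult (A $$ (j, i)) ((pderiv ^^ k) (q $ i)))"
      using v k j A q
      by (simp add: wronskian_mat_index const_poly_mat_mult_index higher_pderiv_sum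
          higher_pderiv_smult del: index_mult_mat_vec)
    also have "\<dots> = (wronskian_mat q * transpose_mat (const_poly_mat A)) $$ (k, j)"
      using k j A q
      by (auto simp: scalar_prod_def const_poly_mat_def wronskian_mat_def atLeast0LessThan
          intro!: sum.cong)
    finally show ?case .
  qed (use A q in \<open>auto simp: wronskian_mat_def const_poly_mat_def\<close>)
  moreover have "det (wronskian_mat q * transpose_mat (const_poly_mat A))
      = wronskian q * [:det A:]"
    using A q
    by (simp add: det_mult[of _ n] det_transpose[of _ n] det_const_poly_mat wronskian_def)
  ultimately show ?thesis by (simp add: wronskian_def)
qed

text \<open>The Wronskian matrix of the monomials is triangular with the factorials on its diagonal.\<close>
lemma wronskian_monomials:
  "\<exists>c :: 'a :: field_char_0. c \<noteq> 0 \<and> wronskian (monomial_vec n) = [:c:]"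
proof (intro exI conjI)
  let ?M = "wronskian_mat (monomial_vec n :: 'a poly vec)"
  have entry: "?M $$ (k, j) = (pderiv ^^ k) (monom 1 j)" if "k < n" "j < n" for k j
    using that by (simp add: wronskian_mat_def monomial_vec_def)
  have ut: "upper_triangular ?M"
  proof (rule upper_triangularI)
    fix k j assume "j < k" "k < dim_row ?M"
    then have kj: "j < k" "k < n" "j < n"
      by (auto simp: wronskian_mat_def monomial_vec_def)
    have "(pderiv ^^ k) (monom 1 j :: 'a poly) = 0"
      using kj by (intro poly_eqI) (simp add: coeff_higher_pderiv)
    with kj show "?M $$ (k, j) = 0" by (simp add: entry)
  qed
  have diag: "(pderiv ^^ k) (monom 1 k) = [:fact k :: 'a:]" for k
    by (rule poly_eqI)
      (auto simp: coeff_higher_pderiv coeff_pCons pochhammer_fact split: nat.split)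
  have "wronskian (monomial_vec n) = (\<Prod>k = 0..<n. [:fact k :: 'a:])"
    unfolding wronskian_def
    by (subst det_upper_triangular[OF ut, of n])
      (auto simp: prod_list_diag_prod entry diag wronskian_mat_def monomial_vec_def
        intro!: prod.cong)
  also have "\<dots> = [:\<Prod>k = 0..<n. fact k:]"
    by (induction n) (simp_all add: one_pCons mult.commute)
  finally show "wronskian (monomial_vec n) = [:\<Prod>k = 0..<n. fact k :: 'a:]" .
  show "(\<Prod>k = 0..<n. fact k :: 'a) \<noteq> 0" by simp
qed

lemma invertible_mat_iff_det_nonzero:
  fixes A :: "'a :: field mat"
  assumes A: "A \<in> carrier_mat n n"
  shows "invertible_mat A \<longleftrightarrow> det A \<noteq> 0"
proof
  assume "invertible_mat A"
  then obtain B where AB: "A * B = 1\<^sub>m n" and BA: "B * A = 1\<^sub>m (dim_row B)"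
    using A by (auto simp: invertible_mat_def inverts_mat_def)
  have "dim_col B = n" "dim_row B = n"
    using arg_cong[OF AB, of dim_col] arg_cong[OF BA, of dim_col] A by auto
  then have "B \<in> carrier_mat n n" by auto
  then have "det A * det B = 1"
    using det_mult[OF A, of B] AB by simp
  then show "det A \<noteq> 0" by auto
next
  assume nz: "det A \<noteq> 0"
  let ?B = "(1 / det A) \<cdot>\<^sub>m adj_mat A"
  have B: "?B \<in> carrier_mat n n" using adj_mat(1)[OF A] by simp
  have one: "(1 / det A) \<cdot>\<^sub>m (det A \<cdot>\<^sub>m 1\<^sub>m n) = (1\<^sub>m n :: 'a mat)"
    using nz by (intro eq_matI) auto
  have "A * ?B = 1\<^sub>m n" "?B * A = 1\<^sub>m n"
    using mult_smult_distrib[OF A adj_mat(1)[OF A]] mult_smult_assoc_mat[OF adj_mat(1)[OF A] A]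
      adj_mat(2,3)[OF A] one by auto
  then show "invertible_mat A"
    using A B unfolding invertible_mat_def inverts_mat_def
    by (intro conjI exI[of _ ?B]) auto
qed

section \<open>The degree of the Wronskian for distinct degrees\<close>

text \<open>The coefficient of the highest degree that the bounds on the factors permit.\<close>
lemma coeff_prod_degree_le:
  fixes f :: "'i \<Rightarrow> 'a :: comm_ring_1 poly"
  assumes "finite S" "\<And>i. i \<in> S \<Longrightarrow> degree (f i) \<le> d i"
  shows "coeff (prod f S) (sum d S) = (\<Prod>i\<in>S. coeff (f i) (d i))"
  using assms
proof (induction S rule: finite_induct)
  case (insert x S)
  have "degree (prod f S) \<le> sum d S"
    by (rule order_trans[OF degree_prod_sum_le[OF insert.hyps(1)]])
      (use insert.prems in \<open>auto intro: sum_mono\<close>)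
  moreover have "degree (f x) \<le> d x" using insert.prems by auto
  moreover have "coeff (p * q) (a + b) = coeff p a * coeff q b"
    if p: "degree p \<le> a" and q: "degree q \<le> b" for p q :: "'a poly" and a b
  proof -
    have "coeff p i * coeff q (a + b - i) = 0" if "i \<le> a + b" "i \<noteq> a" for i
      using that p q by (cases "i < a") (simp_all add: coeff_eq_0)
    then have "coeff (p * q) (a + b)
        = (\<Sum>i\<le>a + b. if i = a then coeff p i * coeff q (a + b - i) else 0)"
      unfolding coeff_mult by (intro sum.cong) auto
    then show ?thesis by simp
  qed
  ultimately show ?case using insert by simp
qed simp

lemma coeff_det_degree_le:
  fixes M :: "'a :: comm_ring_1 poly mat"
  assumes M: "M \<in> carrier_mat n n"
    and deg: "\<And>k j. k < n \<Longrightarrow> j < n \<Longrightarrow> degree (M $$ (k, j)) \<le> d j"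
  shows "coeff (det M) (\<Sum>j<n. d j) = det (mat n n (\<lambda>(k, j). coeff (M $$ (k, j)) (d j)))"
proof -
  have signof: "signof \<pi> = ([:signof \<pi>:] :: 'a poly)" for \<pi> :: "nat \<Rightarrow> nat"
    by (auto simp: sign_def one_pCons)
  have "coeff (signof \<pi> * (\<Prod>j<n. M $$ (\<pi> j, j))) (\<Sum>j<n. d j)
      = signof \<pi> * (\<Prod>j<n. mat n n (\<lambda>(k, j). coeff (M $$ (k, j)) (d j)) $$ (\<pi> j, j))"
    if "\<pi> permutes {0..<n}" for \<pi>
  proof -
    have lt: "\<pi> j < n" if "j < n" for j
      using permutes_in_image[OF \<open>\<pi> permutes {0..<n}\<close>, of j] that by auto
    then have "coeff (\<Prod>j<n. M $$ (\<pi> j, j)) (\<Sum>j<n. d j) = (\<Prod>j<n. coeff (M $$ (\<pi> j, j)) (d j))"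
      by (intro coeff_prod_degree_le) (auto intro: deg)
    then show ?thesis using lt by (subst signof) simp
  qed
  then show ?thesis
    by (subst det_col[OF M], subst det_col[of _ n]) (auto simp: coeff_sum intro!: sum.cong)
qed

text \<open>
  The operator \<open>t\<^sup>k D\<^sup>k\<close> does not shift degrees: it is diagonal on the monomials, and its eigenvalues
  are the falling factorials.
\<close>
lemma coeff_monom_higher_pderiv:
  fixes q :: "'a :: field_char_0 poly"
  shows "coeff (monom 1 k * (pderiv ^^ k) q) m = (\<Prod>i<k. of_nat m - of_nat i) * coeff q m"
proof (induction k)
  case (Suc k)
  show ?case
  proof (cases "m \<le> k")
    case True
    then have "(\<Prod>i<Suc k. of_nat m - of_nat i :: 'a) = 0"
      by (intro prod_zero bexI[of _ m]) auto
    then show ?thesis using True by (simp add: coeff_monom_mult)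
  next
    case False
    then have "m - k = Suc (m - Suc k)" by simp
    moreover have "of_nat (m - k) = (of_nat m - of_nat k :: 'a)"
      using False by (simp add: of_nat_diff)
    ultimately have "coeff (monom 1 (Suc k) * (pderiv ^^ Suc k) q) m
        = (of_nat m - of_nat k) * coeff (monom 1 k * (pderiv ^^ k) q) m"
      using False by (simp add: coeff_monom_mult coeff_pderiv)
    then show ?thesis by (simp add: Suc.IH mult_ac)
  qed
qed simp

text \<open>
  A linear relation among the first \<open>n\<close> falling factorials at \<open>n\<close> distinct naturals is a polynomial of
  degree less than \<open>n\<close> with \<open>n\<close> roots, hence the zero polynomial. Evaluated at the naturals
  \<open>0, 1, \<dots>\<close>, its coefficients then vanish one after the other, since the falling factorial of length
  \<open>k\<close> has the roots \<open>0, \<dots>, k - 1\<close> and no other.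
\<close>
lemma falling_factorial_relation_trivial:
  fixes c :: "nat \<Rightarrow> 'a :: field_char_0"
  assumes inj: "inj_on d {..<n}"
    and rel: "\<And>j. j < n \<Longrightarrow> (\<Sum>k<n. c k * (\<Prod>i<k. of_nat (d j) - of_nat i)) = 0"
    and m: "m < n"
  shows "c m = 0"
proof -
  define F where "F = (\<Sum>k<n. smult (c k) (\<Prod>i<k. [:- of_nat i, 1:]))"
  have poly_F: "poly F x = (\<Sum>k<n. c k * (\<Prod>i<k. x - of_nat i))" for x
    by (simp add: F_def poly_sum poly_prod)
  have "degree F \<le> n - 1"
    unfolding F_def
  proof (intro degree_sum_le)
    fix k assume "k \<in> {..<n}"
    have "degree (\<Prod>i<k. [:- of_nat i, 1 :: 'a:]) \<le> k"
      by (rule order_trans[OF degree_prod_sum_le]) auto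
    then show "degree (smult (c k) (\<Prod>i<k. [:- of_nat i, 1:])) \<le> n - 1"
      using \<open>k \<in> {..<n}\<close> by (intro order_trans[OF degree_smult_le]) auto
  qed simp
  then have "degree F < n" using m by simp
  have "F = 0"
  proof (rule poly_eqI_degree[of "(\<lambda>j. of_nat (d j)) ` {..<n}"])
    have "card ((\<lambda>j. of_nat (d j) :: 'a) ` {..<n}) = n"
      using inj by (subst card_image) (auto simp: inj_on_def)
    then show "degree F < card ((\<lambda>j. of_nat (d j) :: 'a) ` {..<n})"
      "degree (0 :: 'a poly) < card ((\<lambda>j. of_nat (d j) :: 'a) ` {..<n})"
      using \<open>degree F < n\<close> by auto
  qed (auto simp: poly_F rel)
  show ?thesis
    using m
  proof (induction m rule: less_induct)
    case (less m)
    have "c k * (\<Prod>i<k. of_nat m - of_nat i) = 0" if "k < n" "k \<noteq> m" for k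
    proof (cases "k < m")
      case False
      then have "(\<Prod>i<k. of_nat m - of_nat i :: 'a) = 0"
        using \<open>k \<noteq> m\<close> by (intro prod_zero bexI[of _ m]) auto
      then show ?thesis by simp
    qed (use less in simp)
    then have "poly F (of_nat m) = (\<Sum>k<n. if k = m then c k * (\<Prod>i<k. of_nat m - of_nat i) else 0)"
      unfolding poly_F by (intro sum.cong) auto
    then have "c m * (\<Prod>i<m. of_nat m - of_nat i) = 0"
      using \<open>F = 0\<close> less.prems by simp
    then show "c m = 0" by auto
  qed
qed

text \<open>
  Multiplying row \<open>k\<close> of the Wronskian matrix by \<open>t\<^sup>k\<close> bounds every entry of column \<open>j\<close> by the degree
  of \<open>q\<^sub>j\<close>, so that the extreme coefficient can be read off entrywise.
\<close>
lemma coeff_wronskian_distinct_degrees: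
  fixes q :: "'a :: field_char_0 poly vec"
  assumes q: "q \<in> carrier_vec n"
    and nz: "\<And>j. j < n \<Longrightarrow> q $ j \<noteq> 0"
    and inj: "inj_on (\<lambda>j. degree (q $ j)) {..<n}"
  shows "coeff (monom 1 (\<Sum>k<n. k) * wronskian q) (\<Sum>j<n. degree (q $ j)) \<noteq> 0"
proof -
  define d where "d j = degree (q $ j)" for j
  define M where "M = mat_diag n (\<lambda>k. monom (1 :: 'a) k) * wronskian_mat q"
  define C where "C = mat n n (\<lambda>(k, j). coeff (M $$ (k, j)) (d j))"
  have M: "M \<in> carrier_mat n n"
    unfolding M_def using q by (intro mult_carrier_mat[of _ n n]) auto
  have entry: "M $$ (k, j) = monom 1 k * (pderiv ^^ k) (q $ j)" if "k < n" "j < n" for k j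
    using that q by (simp add: M_def mat_diag_mult_left[of _ n n] wronskian_mat_index)
  have deg: "degree (M $$ (k, j)) \<le> d j" if "k < n" "j < n" for k j
    using that
    by (intro degree_le allI impI) (simp add: entry coeff_monom_higher_pderiv d_def coeff_eq_0)
  have "det (mat_diag n (\<lambda>k. monom (1 :: 'a) k)) = (\<Prod>k<n. monom 1 k)"
    by (subst det_upper_triangular[of _ n])
      (auto simp: mat_diag_def prod_list_diag_prod atLeast0LessThan intro!: prod.cong)
  also have "\<dots> = monom 1 (\<Sum>k<n. k)"
    by (induction n) (simp_all add: mult_monom one_pCons monom_0 add.commute)
  finally have det_M: "det M = monom 1 (\<Sum>k<n. k) * wronskian q"
    using q by (simp add: M_def det_mult[of _ n] wronskian_def)
  have "det C \<noteq> 0"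
  proof
    have C: "transpose_mat C \<in> carrier_mat n n" by (simp add: C_def)
    assume "det C = 0"
    then have "det (transpose_mat C) = 0" by (simp add: det_transpose[of _ n] C_def)
    then obtain v where v: "v \<in> carrier_vec n" "v \<noteq> 0\<^sub>v n"
        and Cv: "transpose_mat C *\<^sub>v v = 0\<^sub>v n"
      using det_0_iff_vec_prod_zero_field[OF C] by auto
    have "(\<Sum>k<n. v $ k * (\<Prod>i<k. of_nat (d j) - of_nat i)) = 0" if j: "j < n" for j
    proof -
      have "0 = (transpose_mat C *\<^sub>v v) $ j" using Cv j by simp
      also have "\<dots> = (\<Sum>k<n. (\<Prod>i<k. of_nat (d j) - of_nat i) * coeff (q $ j) (d j) * v $ k)"
        using j v
        by (auto simp: C_def scalar_prod_def entry coeff_monom_higher_pderiv atLeast0LessThan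
            intro!: sum.cong)
      also have "\<dots> = coeff (q $ j) (d j) * (\<Sum>k<n. v $ k * (\<Prod>i<k. of_nat (d j) - of_nat i))"
        by (simp add: sum_distrib_left mult_ac)
      finally show ?thesis using nz[OF j] by (simp add: d_def)
    qed
    moreover have "inj_on d {..<n}" using inj by (simp add: d_def inj_on_def)
    ultimately have "v $ k = 0" if "k < n" for k
      using falling_factorial_relation_trivial[of d n "\<lambda>k. v $ k"] that by blast
    then have "v = 0\<^sub>v n" using v(1) by (intro eq_vecI) auto
    with v(2) show False by simp
  qed
  then show ?thesis
    using coeff_det_degree_le[OF M deg] by (simp add: det_M C_def d_def)
qed

section \<open>Degree bounds from a constant Wronskian\<close>

text \<open>
  Passing from \<open>{0, \<dots>, n - 1}\<close> to \<open>S\<close> replaces the elements that \<open>S\<close> misses by equally many that are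
  at least \<open>n\<close>; if there were any, the sum would increase strictly.
\<close>
lemma minimal_sum_imp_subset:
  fixes S :: "nat set"
  assumes S: "finite S" "card S = n" and le: "\<Sum>S \<le> (\<Sum>k<n. k)"
  shows "S \<subseteq> {..<n}"
proof -
  let ?I = "S \<inter> {..<n}"
  have split: "\<Sum>S = \<Sum>?I + \<Sum>(S - {..<n})" "(\<Sum>k<n. k) = \<Sum>?I + \<Sum>({..<n} - S)"
    using sum.Int_Diff[of S "\<lambda>x. x" "{..<n}"] sum.Int_Diff[of "{..<n}" "\<lambda>x. x" S] S
    by (auto simp: Int_commute)
  have card: "card (S - {..<n}) = card ({..<n} - S)"
    using card_Diff_subset_Int[of S "{..<n}"] card_Diff_subset_Int[of "{..<n}" S] S
    by (simp add: Int_commute)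
  show ?thesis
  proof (rule ccontr)
    assume "\<not> S \<subseteq> {..<n}"
    then have "S - {..<n} \<noteq> {}" by auto
    then have pos: "card (S - {..<n}) > 0" using S by (simp add: card_gt_0_iff)
    then have ne: "{..<n} - S \<noteq> {}" unfolding card by (auto simp: card_gt_0_iff)
    have "\<Sum>({..<n} - S) < (\<Sum>k\<in>{..<n} - S. n)"
      using ne by (intro sum_strict_mono) auto
    also have "\<dots> = (\<Sum>k\<in>S - {..<n}. n)" using card by simp
    also have "\<dots> \<le> \<Sum>(S - {..<n})" by (intro sum_mono) auto
    finally show False using split le by simp
  qed
qed

lemma wronskian_zero_component:
  assumes q: "q \<in> carrier_vec n" and j: "j < n" and "q $ j = 0"
  shows "wronskian q = 0"
proof -
  have "(\<Prod>i<n. wronskian_mat q $$ (\<pi> i, i)) = 0" if "\<pi> permutes {0..<n}" for \<pi>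
  proof (rule prod_zero)
    have "\<pi> j < n" using permutes_in_image[OF that, of j] j by auto
    then show "\<exists>i\<in>{..<n}. wronskian_mat q $$ (\<pi> i, i) = 0"
      using assms by (intro bexI[of _ j]) (auto simp: wronskian_mat_index)
  qed simp
  then show ?thesis
    unfolding wronskian_def
    by (subst det_col[OF wronskian_mat_carrier[OF q]]) (auto intro!: sum.neutral)
qed

lemma wronskian_add_multiple:
  assumes q: "q \<in> carrier_vec n" and "i \<noteq> j" and i: "i < n" and j: "j < n"
  shows "wronskian (vec n (\<lambda>l. if l = i then smult a (q $ j) + q $ i else q $ l)) = wronskian q"
    (is "wronskian ?r = _")
proof -
  have r: "?r \<in> carrier_vec n" by simp
  have "wronskian_mat ?r = addcol [:a:] i j (wronskian_mat q)"
    using q i j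
    by (intro eq_matI) (auto simp: wronskian_mat_def higher_pderiv_add higher_pderiv_smult)
  then show ?thesis
    using \<open>i \<noteq> j\<close> q j by (simp add: wronskian_def det_addcol[of j n])
qed

lemma degree_less_if_wronskian_const:
  fixes q :: "'a :: field_char_0 poly vec"
  assumes "q \<in> carrier_vec n" "wronskian q = [:c:]" "c \<noteq> 0" "j < n"
  shows "degree (q $ j) < n"
  using assms
proof (induction "\<Sum>j<n. degree (q $ j)" arbitrary: q j rule: less_induct)
  case less
  note q = less.prems(1)
  have nz: "q $ j \<noteq> 0" if "j < n" for j
    using wronskian_zero_component[OF q that] less.prems(2,3) by auto
  show ?case
  proof (cases "inj_on (\<lambda>j. degree (q $ j)) {..<n}")
    case True
    let ?S = "(\<lambda>j. degree (q $ j)) ` {..<n}"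
    have "coeff (monom c (\<Sum>k<n. k)) (\<Sum>j<n. degree (q $ j)) \<noteq> 0"
      using coeff_wronskian_distinct_degrees[OF q nz True] less.prems(2)
      by (simp add: smult_monom)
    then have "\<Sum>?S = (\<Sum>k<n. k)"
      using True by (auto simp: sum.reindex split: if_splits)
    then have "?S \<subseteq> {..<n}"
      using True by (intro minimal_sum_imp_subset) (auto simp: card_image)
    then show ?thesis using \<open>j < n\<close> by auto
  next
    case False
    then obtain i l where il: "i < n" "l < n" "i \<noteq> l" and eq: "degree (q $ i) = degree (q $ l)"
      by (auto simp: inj_on_def)
    \<comment> \<open>The multiplier makes the leading terms of the two components cancel.\<close>
    define a where "a = - (lead_coeff (q $ i) / lead_coeff (q $ l))"
    define r where "r = vec n (\<lambda>m. if m = i then smult a (q $ l) + q $ i else q $ m)"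
    have r: "r \<in> carrier_vec n" by (simp add: r_def)
    have W: "wronskian r = [:c:]"
      using wronskian_add_multiple[OF q il(3,1,2)] less.prems(2) by (simp add: r_def)
    have "r $ i \<noteq> 0"
      using wronskian_zero_component[OF r il(1)] W less.prems(3) by auto
    moreover have "coeff (r $ i) (degree (q $ i)) = 0"
      using il nz[OF il(2)] eq by (simp add: r_def a_def)
    moreover have "degree (r $ i) \<le> degree (q $ i)"
      using il eq by (auto simp: r_def intro: degree_add_le order_trans[OF degree_smult_le])
    ultimately have lt: "degree (r $ i) < degree (q $ i)"
      by (metis leading_coeff_0_iff order_less_le)
    have other: "r $ m = q $ m" if "m < n" "m \<noteq> i" for m
      using that by (simp add: r_def)
    have "(\<Sum>m<n. degree (r $ m)) < (\<Sum>m<n. degree (q $ m))"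
    proof (rule sum_strict_mono_ex1)
      show "\<forall>m\<in>{..<n}. degree (r $ m) \<le> degree (q $ m)"
        using lt other by (metis lessThan_iff less_imp_le order_refl)
      show "\<exists>m\<in>{..<n}. degree (r $ m) < degree (q $ m)"
        using lt il(1) by auto
    qed simp
    then have IH: "degree (r $ m) < n" if "m < n" for m
      using less.hyps[OF _ r W less.prems(3) that] by simp
    \<comment> \<open>The altered component had the degree of component \<open>l\<close>, which is still present.\<close>
    show ?thesis
      using IH[OF \<open>j < n\<close>] IH[OF il(2)] other[OF \<open>j < n\<close>] other[OF il(2)] il(3) eq
      by (cases "j = i") auto
  qed
qed

section \<open>Polynomial families with constant Wronskian\<close>

theorem theorem4:
  fixes p :: "'a :: field_char_0 poly vec" and n :: nat
  assumes "n \<ge> 1"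
    and "p \<in> carrier_vec n"
    and "lin_indep_family p"
  shows "(\<exists>c :: 'a. c \<noteq> 0 \<and> wronskian p = [:c:]) \<longleftrightarrow>
    (\<exists>A \<in> carrier_mat n n. invertible_mat A \<and>
       p = const_poly_mat A *\<^sub>v monomial_vec n)"
proof -
  obtain w :: 'a where w: "w \<noteq> 0" "wronskian (monomial_vec n) = [:w:]"
    using wronskian_monomials by blast
  have W: "wronskian (const_poly_mat A *\<^sub>v monomial_vec n) = [:w * det A:]"
    if "A \<in> carrier_mat n n" for A
    using wronskian_const_mult[OF that monomial_vec_carrier] w by simp
  show ?thesis
  proof
    assume "\<exists>c :: 'a. c \<noteq> 0 \<and> wronskian p = [:c:]"
    then obtain c where c: "c \<noteq> 0" "wronskian p = [:c:]" by blast
    define A where "A = mat n n (\<lambda>(j, i). coeff (p $ j) i)"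
    have A: "A \<in> carrier_mat n n" by (simp add: A_def)
    have p_eq: "p = const_poly_mat A *\<^sub>v monomial_vec n"
    proof (rule eq_vecI)
      fix j assume "j < dim_vec (const_poly_mat A *\<^sub>v monomial_vec n)"
      then have j: "j < n" using A by (simp add: const_poly_mat_def)
      have "degree (p $ j) < n"
        using degree_less_if_wronskian_const[OF assms(2) c(2,1) j] .
      then have "p $ j = (\<Sum>i<n. monom (coeff (p $ j) i) i)"
        by (intro poly_eqI) (auto simp: coeff_sum coeff_eq_0)
      also have "\<dots> = (const_poly_mat A *\<^sub>v monomial_vec n) $ j"
        using j A
        by (subst const_poly_mat_mult_index[OF A]) (simp_all add: A_def monomial_vec_def smult_monom)
      finally show "p $ j = (const_poly_mat A *\<^sub>v monomial_vec n) $ j" .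
    qed (use A assms(2) in \<open>simp add: const_poly_mat_def\<close>)
    with W[OF A] c have "det A \<noteq> 0" by auto
    with A p_eq show "\<exists>A \<in> carrier_mat n n. invertible_mat A \<and>
       p = const_poly_mat A *\<^sub>v monomial_vec n"
      using invertible_mat_iff_det_nonzero by blast
  next
    assume "\<exists>A \<in> carrier_mat n n. invertible_mat A \<and> p = const_poly_mat A *\<^sub>v monomial_vec n"
    then show "\<exists>c :: 'a. c \<noteq> 0 \<and> wronskian p = [:c:]"
      using W w(1) invertible_mat_iff_det_nonzero by (metis mult_eq_0_iff)
  qed
qed

end
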